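(* Suppose that for all integers $k \ge 0$ and $\ell \ge 3$ there exists an integer $f(k,\ell) \ge 0$ such that every tournament $T$ with $\overrightarrow{\chi}(T) \ge f(k,\ell)$ contains a subdigraph $H \subseteq T$ with $\overrightarrow{\chi}(H) > k$ and $\mathrm{girth}(H) > \ell$. Then for all integers $k \ge 0$ and $\ell \ge 3$ there exists an integer $f'(k,\ell) \ge 0$ such that every graph $G$ with $\chi(G) \ge f'(k,\ell)$ contains a subgraph $H \subseteq G$ with $\chi(H) > k$ and $\mathrm{girth}(H) > \ell$.
   Context: All graphs and digraphs are finite; graphs are simple and undirected. A tournament is a digraph with exactly one arc between every pair of distinct vertices (and no loops). Subgraphs and subdigraphs are not necessarily induced. $\chi(G)$ denotes the chromatic number of a graph $G$. The dichromatic number $\overrightarrow{\chi}(D)$ of a digraph $D$ is the least integer $k \ge 0$ such that the vertices of $D$ can be partitioned into $k$ sets each inducing an acyclic subdigraph (no directed cycle). The girth $\mathrm{girth}(G)$ of a graph $G$ is the minimum size of a cycle in $G$ ($+\infty$ if $G$ has no cycle). The girth $\mathrm{girth}(D)$ of a digraph $D$ is the girth of its underlying undirected graph. *)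

theory Defs
  imports "Graph_Theory.Graph_Theory"
begin

text \<open>
  Digraphs are the pair digraphs of the Graph\_Theory entry, and finite simple undirected
  graphs are its symmetric loopfree finite pair digraphs (\<^locale>\<open>pair_graph\<close>), where an edge
  is a pair of opposite arcs. The null graph is allowed.
\<close>

locale tournament = pair_digraph T for T :: "'a pair_pre_digraph" +
  assumes one_arc: "\<lbrakk>u \<in> pverts T; v \<in> pverts T; u \<noteq> v\<rbrakk>
    \<Longrightarrow> (u, v) \<in> parcs T \<longleftrightarrow> (v, u) \<notin> parcs T"

definition acyclic_digraph :: "('a, 'b) pre_digraph \<Rightarrow> bool" where
  "acyclic_digraph D \<longleftrightarrow> (\<nexists>p. pre_digraph.cycle D p)"

text \<open>
  Partitions into \<open>k\<close> sets are given by maps \<open>c\<close> into \<open>{..<k}\<close>, so parts may be empty;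
  this does not affect the minimum.
\<close>

definition dichromatic_number :: "('a, 'b) pre_digraph \<Rightarrow> nat" where
  "dichromatic_number D = (LEAST k. \<exists>c :: 'a \<Rightarrow> nat. c ` verts D \<subseteq> {..<k} \<and>
     (\<forall>i<k. acyclic_digraph (D \<restriction> {v \<in> verts D. c v = i})))"

definition chromatic_number :: "('a, 'b) pre_digraph \<Rightarrow> nat" where
  "chromatic_number G = (LEAST k. \<exists>c :: 'a \<Rightarrow> nat. c ` verts G \<subseteq> {..<k} \<and>
     (\<forall>(u, v) \<in> arcs_ends G. c u \<noteq> c v))"

text \<open>
  \<^const>\<open>pre_digraph.cycle\<close> refers to directed cycles, so in a symmetric digraph every edge
  yields a cycle of length 2, going back and forth. The directed cycles of length at least 3
  are exactly the traversals of cycles of the undirected graph. \<^const>\<open>Inf\<close> of the empty set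
  in \<^typ>\<open>enat\<close> is \<open>\<infinity>\<close>.
\<close>

definition girth :: "('a, 'b) pre_digraph \<Rightarrow> enat" where
  "girth G = (INF p \<in> {p. pre_digraph.cycle G p \<and> length p \<ge> 3}. enat (length p))"

text \<open>\<^const>\<open>mk_symmetric\<close> is the underlying undirected graph.\<close>

definition digraph_girth :: "('a, 'b) pre_digraph \<Rightarrow> enat" where
  "digraph_girth D = girth (with_proj (mk_symmetric D))"

end

theory Submission
  imports Defs
begin

text \<open>
  Order the vertices of \<open>G\<close> arbitrarily and let \<open>T\<close> be the tournament whose backward arcs are the
  edges of \<open>G\<close>. On a set of vertices that is acyclic in \<open>T\<close>, the edges of \<open>G\<close> are the inversions
  between two linear orders, so they form a comparability graph there; longest chains colour it with
  at most \<open>\<omega>(G)\<close> colours, and hence \<open>\<chi>(G)\<close> is at most \<open>\<omega>(G)\<close> times the dichromatic number of \<open>T\<close>.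
  Conversely, if \<open>H \<subseteq> T\<close>, then a proper colouring of \<open>H \<inter> G\<close> leaves only forward arcs of \<open>H\<close> in
  each class, so \<open>\<chi>(H \<inter> G)\<close> is at least the dichromatic number of \<open>H\<close>.

  Large cliques of \<open>G\<close> are dealt with separately: they contain the underlying graph of a fixed digraph
  of large girth and dichromatic number, obtained from the hypothesis applied to an iterated
  blow-up of the cyclic triangle.
\<close>

section \<open>Colourings\<close>

lemma cycle_with_proj_iff:
  "pre_digraph.cycle (with_proj D) p \<longleftrightarrow>
    (\<exists>u. u \<in> pverts D \<and> set p \<subseteq> parcs D \<and> pcas u p u \<and> distinct (tl (pawalk_verts u p)) \<and> p \<noteq> [])"
  by (simp add: pre_digraph.cycle_def pre_digraph.awalk_def cas_with_proj_eq
      awalk_verts_with_proj_eq)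

lemma induce_subgraph_with_proj:
  "with_proj D \<restriction> S = with_proj \<lparr>pverts = S, parcs = {(u, v) \<in> parcs D. u \<in> S \<and> v \<in> S}\<rparr>"
  by (auto simp: induce_subgraph_def with_proj_def)

lemma pcas_increasing:
  fixes p :: "('a :: order \<times> 'a) list"
  assumes "pcas u p v" "\<And>x y. (x, y) \<in> set p \<Longrightarrow> x < y" "p \<noteq> []"
  shows "u < v"
  using assms
proof (induction p arbitrary: u)
  case (Cons e p)
  have "u < snd e"
    using Cons.prems by (cases e) auto
  moreover have "snd e < v" if "p \<noteq> []"
    using Cons.IH[of "snd e"] Cons.prems that by auto
  moreover have "snd e = v" if "p = []"
    using Cons.prems that by simp
  ultimately show ?case
    by (metis less_trans)
qed simp

text \<open>Along a closed walk in \<open>S\<close> the vertices would increase strictly, yet return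
  to the start. This certifies acyclicity of classes that keep only forward arcs.\<close>

lemma acyclic_digraph_increasing:
  fixes D :: "('a :: order) pair_pre_digraph"
  assumes "\<And>u v. (u, v) \<in> parcs D \<Longrightarrow> u \<in> S \<Longrightarrow> v \<in> S \<Longrightarrow> u < v"
  shows "acyclic_digraph (with_proj D \<restriction> S)"
  unfolding acyclic_digraph_def induce_subgraph_with_proj cycle_with_proj_iff
proof (intro notI, elim exE conjE)
  fix p u
  assume "set p \<subseteq> parcs \<lparr>pverts = S, parcs = {(u, v) \<in> parcs D. u \<in> S \<and> v \<in> S}\<rparr>"
    and "pcas u p u" "p \<noteq> []"
  then have "u < u"
    using assms by (intro pcas_increasing[of u p u]) auto
  then show False by simp
qed

lemma dichromatic_number_le:
  assumes "\<And>v. v \<in> verts D \<Longrightarrow> c v < k"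
    and "\<And>i. i < k \<Longrightarrow> acyclic_digraph (D \<restriction> {v \<in> verts D. c v = i})"
  shows "dichromatic_number D \<le> k"
  unfolding dichromatic_number_def using assms by (intro Least_le exI[of _ c]) auto

lemma chromatic_number_le:
  assumes "\<And>v. v \<in> verts G \<Longrightarrow> c v < k"
    and "\<And>u v. (u, v) \<in> arcs_ends G \<Longrightarrow> c u \<noteq> c v"
  shows "chromatic_number G \<le> k"
  unfolding chromatic_number_def using assms by (intro Least_le exI[of _ c]) auto

text \<open>The \<open>LEAST\<close> is attained once some colouring exists. An injective colouring
  serves: each class has at most one vertex, and there are no loops.\<close>

lemma dichromatic_number_colouring:
  assumes "pair_digraph D"
  obtains c where "\<And>v. v \<in> pverts D \<Longrightarrow> c v < dichromatic_number (with_proj D)"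
    and "\<And>i. i < dichromatic_number (with_proj D) \<Longrightarrow>
      acyclic_digraph (with_proj D \<restriction> {v \<in> pverts D. c v = i})"
proof -
  interpret pair_digraph D by fact
  obtain f :: "'a \<Rightarrow> nat" and n where f: "f ` pverts D = {i. i < n}" "inj_on f (pverts D)"
    using finite_imp_inj_to_nat_seg[OF pair_finite_verts] by blast
  have "acyclic_digraph (with_proj D \<restriction> {v \<in> pverts D. f v = i})" for i
    unfolding acyclic_digraph_def induce_subgraph_with_proj cycle_with_proj_iff
  proof (intro notI, elim exE conjE)
    fix p u
    let ?S = "{v \<in> pverts D. f v = i}"
    assume p: "set p \<subseteq> parcs \<lparr>pverts = ?S, parcs = {(u, v) \<in> parcs D. u \<in> ?S \<and> v \<in> ?S}\<rparr>"
      and "p \<noteq> []"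
    then obtain x y where "(x, y) \<in> set p"
      by (cases p) auto
    with p have "(x, y) \<in> parcs D" "x = y"
      using f(2) by (auto dest!: subsetD simp: inj_on_def)
    then show False
      using pair_no_loops by force
  qed
  then have "\<exists>k. \<exists>c :: 'a \<Rightarrow> nat. c ` verts (with_proj D) \<subseteq> {..<k} \<and>
      (\<forall>i<k. acyclic_digraph (with_proj D \<restriction> {v \<in> verts (with_proj D). c v = i}))"
    using f(1) by (intro exI[of _ n] exI[of _ f]) auto
  then have "\<exists>c :: 'a \<Rightarrow> nat. c ` verts (with_proj D) \<subseteq> {..<dichromatic_number (with_proj D)} \<and>
      (\<forall>i<dichromatic_number (with_proj D).
        acyclic_digraph (with_proj D \<restriction> {v \<in> verts (with_proj D). c v = i}))"
    unfolding dichromatic_number_def by (rule LeastI_ex)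
  then show thesis
    using that by auto
qed

lemma chromatic_number_colouring:
  assumes "pair_digraph G"
  obtains c where "\<And>v. v \<in> pverts G \<Longrightarrow> c v < chromatic_number (with_proj G)"
    and "\<And>u v. (u, v) \<in> parcs G \<Longrightarrow> c u \<noteq> c v"
proof -
  interpret pair_digraph G by fact
  obtain f :: "'a \<Rightarrow> nat" and n where f: "f ` pverts G = {i. i < n}" "inj_on f (pverts G)"
    using finite_imp_inj_to_nat_seg[OF pair_finite_verts] by blast
  have "f u \<noteq> f v" if "(u, v) \<in> parcs G" for u v
    using inj_onD[OF f(2)] that in_arcsD1 in_arcsD2 pair_no_loops[OF that] by auto
  then have "\<exists>k. \<exists>c :: 'a \<Rightarrow> nat. c ` verts (with_proj G) \<subseteq> {..<k} \<and>
      (\<forall>(u, v) \<in> arcs_ends (with_proj G). c u \<noteq> c v)"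
    using f(1) by (intro exI[of _ n] exI[of _ f]) auto
  then have "\<exists>c :: 'a \<Rightarrow> nat. c ` verts (with_proj G) \<subseteq> {..<chromatic_number (with_proj G)} \<and>
      (\<forall>(u, v) \<in> arcs_ends (with_proj G). c u \<noteq> c v)"
    unfolding chromatic_number_def by (rule LeastI_ex)
  then show thesis
    using that by fastforce
qed

section \<open>Images of subdigraphs in graphs\<close>

lemma pcas_map: "pcas u p v \<Longrightarrow> pcas (g u) (map (map_prod g g) p) (g v)"
  by (induction p arbitrary: u) auto

lemma pawalk_verts_map: "pawalk_verts (g u) (map (map_prod g g) p) = map g (pawalk_verts u p)"
  by (induction p arbitrary: u) auto

lemma set_pawalk_verts: "set (pawalk_verts u p) \<subseteq> insert u (fst ` set p \<union> snd ` set p)"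
proof (induction p arbitrary: u)
  case (Cons e p)
  then show ?case
    using Cons.IH[of "snd e"] by auto
qed simp

text \<open>Injectivity keeps the vertices of a cycle distinct, so each cycle of \<open>H\<close> is
  carried to a cycle of \<open>M\<close> of the same length.\<close>

lemma girth_le_girth_of_injection:
  assumes "pair_wf_digraph H" and g: "inj_on g (pverts H)" "g ` pverts H \<subseteq> pverts M"
    and arcs: "\<And>u v. (u, v) \<in> parcs H \<Longrightarrow> (g u, g v) \<in> parcs M"
  shows "girth (with_proj M) \<le> girth (with_proj H)"
  unfolding girth_def
proof (rule INF_greatest)
  interpret pair_wf_digraph H by fact
  fix p assume "p \<in> {p. pre_digraph.cycle (with_proj H) p \<and> 3 \<le> length p}"
  then obtain u where u: "u \<in> pverts H" "set p \<subseteq> parcs H" "pcas u p u"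
      "distinct (tl (pawalk_verts u p))" "p \<noteq> []" and len: "3 \<le> length p"
    unfolding cycle_with_proj_iff by auto
  let ?q = "map (map_prod g g) p"
  have "set (pawalk_verts u p) \<subseteq> pverts H"
    using set_pawalk_verts[of u p] u(1,2) arc_fst_in_verts arc_snd_in_verts by blast
  then have "set (tl (pawalk_verts u p)) \<subseteq> pverts H"
    by (cases "pawalk_verts u p") auto
  then have "distinct (tl (pawalk_verts (g u) ?q))"
    using u(4) inj_on_subset[OF g(1)] by (simp add: pawalk_verts_map distinct_map flip: map_tl)
  moreover have "set ?q \<subseteq> parcs M"
    using u(2) arcs by auto
  ultimately have "pre_digraph.cycle (with_proj M) ?q"
    unfolding cycle_with_proj_iff using u g(2) pcas_map[OF u(3), of g]
    by (intro exI[of _ "g u"]) auto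
  with len show "(INF q \<in> {q. pre_digraph.cycle (with_proj M) q \<and> 3 \<le> length q}. enat (length q))
      \<le> enat (length p)"
    by (intro INF_lower2[of ?q]) auto
qed

text \<open>The assumption \<open>backward\<close> covers both uses: \<open>H\<close> placed inside
  a clique, and \<open>H\<close> inside a tournament whose backward arcs are edges of
  \<open>G\<close>. A proper colouring of \<open>H'\<close> pulls back along \<open>g\<close> to
  classes in which \<open>H\<close> has only forward arcs.\<close>

lemma subgraph_of_injection:
  fixes G :: "'a pair_pre_digraph" and H :: "nat pair_pre_digraph"
  assumes "pair_graph G" "pair_digraph H"
    and g: "inj_on g (pverts H)" "g ` pverts H \<subseteq> pverts G"
    and backward: "\<And>i j. (i, j) \<in> parcs H \<Longrightarrow> i < j \<or> (g i, g j) \<in> parcs G"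
  obtains H' where "pair_graph H'" "subgraph (with_proj H') (with_proj G)"
    "dichromatic_number (with_proj H) \<le> chromatic_number (with_proj H')"
    "digraph_girth (with_proj H) \<le> girth (with_proj H')"
proof
  interpret G: pair_graph G by fact
  interpret H: pair_digraph H by fact
  \<comment> \<open>All vertices of \<open>H\<close> are kept, but only those underlying edges whose
    images are edges of \<open>G\<close>.\<close>
  define H' where "H' = \<lparr>pverts = g ` pverts H,
    parcs = map_prod g g ` parcs (mk_symmetric (with_proj H)) \<inter> parcs G\<rparr>"
  have sym: "parcs (mk_symmetric (with_proj H)) = parcs H \<union> (parcs H)\<inverse>"
    by (force simp: parcs_mk_symmetric)
  show pg: "pair_graph H'"
  proof unfold_locales
    show "symmetric (with_proj H')"
      using G.arcs_symmetric unfolding symmetric_def H'_def sym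
      by (force intro!: symI)
  qed (auto simp: H'_def sym intro: H.in_arcsD1 H.in_arcsD2 dest: G.pair_no_loops)
  interpret H': pair_graph H' by (fact pg)
  show "subgraph (with_proj H') (with_proj G)"
    unfolding subgraph_def using g(2) G.wf_digraph H'.wf_digraph
    by (auto simp: H'_def compatible_def)
  show "dichromatic_number (with_proj H) \<le> chromatic_number (with_proj H')"
  proof (rule chromatic_number_colouring[OF H'.pair_digraph])
    fix c assume c: "\<And>v. v \<in> pverts H' \<Longrightarrow> c v < chromatic_number (with_proj H')"
      "\<And>u v. (u, v) \<in> parcs H' \<Longrightarrow> c u \<noteq> c v"
    show ?thesis
    proof (rule dichromatic_number_le[of _ "c \<circ> g"])
      fix i
      show "acyclic_digraph (with_proj H \<restriction> {v \<in> verts (with_proj H). (c \<circ> g) v = i})"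
      proof (rule acyclic_digraph_increasing)
        fix u v assume uv: "(u, v) \<in> parcs H" "u \<in> {v \<in> verts (with_proj H). (c \<circ> g) v = i}"
          "v \<in> {v \<in> verts (with_proj H). (c \<circ> g) v = i}"
        then have "(g u, g v) \<notin> parcs H'"
          using c(2) by force
        with uv(1) have "(g u, g v) \<notin> parcs G"
          by (force simp: H'_def sym)
        then show "u < v"
          using backward uv(1) by blast
      qed
    qed (use c(1) in \<open>auto simp: H'_def\<close>)
  qed
  have inv: "inv_into (pverts H) g (g i) = i" if "i \<in> pverts H" for i
    using g(1) that by simp
  show "digraph_girth (with_proj H) \<le> girth (with_proj H')"
    unfolding digraph_girth_def
  \<comment> \<open>The inverse of \<open>g\<close> embeds \<open>H'\<close> into the underlying
    graph of \<open>H\<close>, so \<open>H'\<close> can only lose short cycles.\<close>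
  proof (rule girth_le_girth_of_injection[of _ "inv_into (pverts H) g"])
    show "(inv_into (pverts H) g u, inv_into (pverts H) g v) \<in> parcs (mk_symmetric (with_proj H))"
      if "(u, v) \<in> parcs H'" for u v
      using that inv H.in_arcsD1 H.in_arcsD2 by (auto simp: H'_def sym)
  qed (use H'.pair_wf_digraph inv in \<open>auto simp: H'_def intro: inj_on_inv_into\<close>)
qed

section \<open>Tournaments of large dichromatic number\<close>

text \<open>On numbers below \<open>3 ^ k\<close>, read with \<open>k\<close> ternary digits, the
  most significant differing digit decides the arc, along the cycle 0, 1, 2, 0.\<close>

primrec blowup_arc :: "nat \<Rightarrow> nat \<Rightarrow> nat \<Rightarrow> bool" where
  "blowup_arc 0 x y \<longleftrightarrow> False"
| "blowup_arc (Suc k) x y \<longleftrightarrow>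
    (if x div 3 ^ k = y div 3 ^ k then blowup_arc k (x mod 3 ^ k) (y mod 3 ^ k)
     else y div 3 ^ k = Suc (x div 3 ^ k) mod 3)"

definition triangle_blowup :: "nat \<Rightarrow> nat pair_pre_digraph" where
  "triangle_blowup k = \<lparr>pverts = {..<3 ^ k}, parcs = {(x, y). x < 3 ^ k \<and> y < 3 ^ k \<and> blowup_arc k x y}\<rparr>"

lemma blowup_arc_irrefl: "\<not> blowup_arc k x x"
  by (induction k arbitrary: x) auto

lemma less_3_cases: "(n :: nat) < 3 \<longleftrightarrow> n = 0 \<or> n = 1 \<or> n = 2"
  by presburger

lemma cyclic_triangle_one_arc:
  fixes a b :: nat
  assumes "a < 3" "b < 3" "a \<noteq> b"
  shows "b = Suc a mod 3 \<longleftrightarrow> a \<noteq> Suc b mod 3"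
proof -
  have "a = 0 \<or> a = 1 \<or> a = 2" "b = 0 \<or> b = 1 \<or> b = 2"
    using assms(1,2) unfolding less_3_cases .
  then show ?thesis
    using assms(3) by (elim disjE) simp_all
qed

lemma blowup_arc_one_arc:
  assumes "x < 3 ^ k" "y < 3 ^ k" "x \<noteq> y"
  shows "blowup_arc k x y \<longleftrightarrow> \<not> blowup_arc k y x"
  using assms
proof (induction k arbitrary: x y)
  case (Suc k)
  show ?case
  proof (cases "x div 3 ^ k = y div 3 ^ k")
    case True
    then have "x mod 3 ^ k \<noteq> y mod 3 ^ k"
      using Suc.prems(3) by (metis div_mult_mod_eq)
    then show ?thesis
      using True Suc.IH[of "x mod 3 ^ k" "y mod 3 ^ k"] by simp
  next
    case False
    moreover have "x div 3 ^ k < 3" "y div 3 ^ k < 3"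
      using Suc.prems by (simp_all add: less_mult_imp_div_less)
    ultimately show ?thesis
      unfolding blowup_arc.simps using cyclic_triangle_one_arc by metis
  qed
qed simp

lemma tournament_triangle_blowup: "tournament (triangle_blowup k)"
proof unfold_locales
  show "finite (parcs (triangle_blowup k))"
    by (rule finite_subset[of _ "{..<3 ^ k} \<times> {..<3 ^ k}"]) (auto simp: triangle_blowup_def)
  show "(u, v) \<in> parcs (triangle_blowup k) \<longleftrightarrow> (v, u) \<notin> parcs (triangle_blowup k)"
    if "u \<in> pverts (triangle_blowup k)" "v \<in> pverts (triangle_blowup k)" "u \<noteq> v" for u v
    using that blowup_arc_one_arc[of u k v] by (auto simp: triangle_blowup_def)
qed (auto simp: triangle_blowup_def blowup_arc_irrefl)

text \<open>
  A colour that occurs in all three copies of the previous blow-up yields a triangle across the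
  copies; otherwise some copy avoids it.
\<close>

lemma monochromatic_triangle_blowup:
  assumes "finite C" "card C \<le> k" "c ` {..<3 ^ k} \<subseteq> C"
  shows "\<exists>x<3 ^ k. \<exists>y<3 ^ k. \<exists>z<3 ^ k. blowup_arc k x y \<and> blowup_arc k y z \<and> blowup_arc k z x \<and>
    c x = c y \<and> c y = c z"
  using assms
proof (induction k arbitrary: c C)
  case (Suc k)
  let ?m = "3 ^ k :: nat"
  \<comment> \<open>The number \<open>i * ?m + x\<close> is the vertex \<open>x\<close> of copy
    \<open>i\<close>: its leading digit is \<open>i\<close>.\<close>
  have lt: "i * ?m + x < 3 ^ Suc k" if "i < 3" "x < ?m" for i x
  proof -
    have "i * ?m + x < Suc i * ?m" using that by simp
    also have "\<dots> \<le> 3 * ?m" using that by (intro mult_right_mono) auto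
    finally show ?thesis by simp
  qed
  have dm: "(i * ?m + x) div ?m = i" "(i * ?m + x) mod ?m = x" if "x < ?m" for i x
    using that by auto
  have "c 0 \<in> C"
    using Suc.prems(3) by auto
  show ?case
  \<comment> \<open>The colour tested is \<open>c 0\<close> because it surely lies in
    \<open>C\<close>; a copy that avoids it uses at most \<open>k\<close> colours, as the induction
    requires.\<close>
  proof (cases "\<forall>i<3. \<exists>x<?m. c (i * ?m + x) = c 0")
    case True
    then obtain x y z where *: "x < ?m" "c (0 * ?m + x) = c 0" "y < ?m" "c (1 * ?m + y) = c 0"
        "z < ?m" "c (2 * ?m + z) = c 0"
      by (metis less_3_cases)
    then have "blowup_arc (Suc k) (0 * ?m + x) (1 * ?m + y)"
        "blowup_arc (Suc k) (1 * ?m + y) (2 * ?m + z)"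
        "blowup_arc (Suc k) (2 * ?m + z) (0 * ?m + x)"
      by (simp_all only: blowup_arc.simps dm) auto
    then show ?thesis
      using * lt[of 0 x] lt[of 1 y] lt[of 2 z] by (metis less_3_cases)
  next
    case False
    then obtain i where i: "i < 3" "\<And>x. x < ?m \<Longrightarrow> c (i * ?m + x) \<noteq> c 0"
      by blast
    have "\<exists>x<?m. \<exists>y<?m. \<exists>z<?m. blowup_arc k x y \<and> blowup_arc k y z \<and> blowup_arc k z x \<and>
      c (i * ?m + x) = c (i * ?m + y) \<and> c (i * ?m + y) = c (i * ?m + z)"
    proof (rule Suc.IH[of "C - {c 0}" "\<lambda>x. c (i * ?m + x)"])
      show "card (C - {c 0}) \<le> k"
        using Suc.prems \<open>c 0 \<in> C\<close> by simp
      show "(\<lambda>x. c (i * ?m + x)) ` {..<?m} \<subseteq> C - {c 0}"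
        using i(2) lt[OF i(1)] by (auto intro!: subsetD[OF Suc.prems(3)])
    qed (use Suc.prems in auto)
    then obtain x y z where *: "x < ?m" "y < ?m" "z < ?m" and
        "blowup_arc k x y" "blowup_arc k y z" "blowup_arc k z x" and
        c: "c (i * ?m + x) = c (i * ?m + y)" "c (i * ?m + y) = c (i * ?m + z)"
      by blast
    then have "blowup_arc (Suc k) (i * ?m + x) (i * ?m + y)"
        "blowup_arc (Suc k) (i * ?m + y) (i * ?m + z)"
        "blowup_arc (Suc k) (i * ?m + z) (i * ?m + x)"
      by (simp_all only: blowup_arc.simps dm) auto
    then show ?thesis
      using * lt[OF i(1)] c by blast
  qed
\<comment> \<open>For \<open>k = 0\<close> the palette \<open>C\<close> is empty although it must
  contain \<open>c 0\<close>.\<close>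
qed auto

lemma not_acyclic_digraph_triangle:
  assumes "(u, v) \<in> parcs D" "(v, w) \<in> parcs D" "(w, u) \<in> parcs D"
    and "{u, v, w} \<subseteq> S" "u \<noteq> v" "v \<noteq> w" "w \<noteq> u"
  shows "\<not> acyclic_digraph (with_proj D \<restriction> S)"
  unfolding acyclic_digraph_def induce_subgraph_with_proj cycle_with_proj_iff not_not
  using assms by (intro exI[of _ "[(u, v), (v, w), (w, u)]"] exI[of _ u]) auto

text \<open>With at most \<open>k\<close> classes, one of them would contain a directed triangle.
  Thus tournaments reach every threshold that the hypothesis may demand.\<close>

lemma dichromatic_number_triangle_blowup: "k < dichromatic_number (with_proj (triangle_blowup k))"
proof (rule ccontr)
  assume le: "\<not> ?thesis"
  interpret tournament "triangle_blowup k" by (rule tournament_triangle_blowup)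
  let ?T = "triangle_blowup k" and ?d = "dichromatic_number (with_proj (triangle_blowup k))"
  obtain c where c: "\<And>v. v \<in> pverts ?T \<Longrightarrow> c v < ?d"
      "\<And>i. i < ?d \<Longrightarrow> acyclic_digraph (with_proj ?T \<restriction> {v \<in> pverts ?T. c v = i})"
    by (rule dichromatic_number_colouring[OF pair_digraph], rule that)
  have "\<exists>x<3 ^ k. \<exists>y<3 ^ k. \<exists>z<3 ^ k. blowup_arc k x y \<and> blowup_arc k y z \<and> blowup_arc k z x \<and>
    c x = c y \<and> c y = c z"
    using c(1) le by (intro monochromatic_triangle_blowup[of "{..<?d}"]) (auto simp: triangle_blowup_def)
  then obtain x y z where xyz: "x < 3 ^ k" "y < 3 ^ k" "z < 3 ^ k"
      "blowup_arc k x y" "blowup_arc k y z" "blowup_arc k z x" "c x = c y" "c y = c z"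
    by blast
  have "\<not> acyclic_digraph (with_proj ?T \<restriction> {v \<in> pverts ?T. c v = c x})"
    using xyz blowup_arc_irrefl
    by (intro not_acyclic_digraph_triangle[of x y _ z]) (auto simp: triangle_blowup_def)
  then show False
    using c xyz(1) by (simp add: triangle_blowup_def)
qed

section \<open>Tournaments with prescribed backward arcs\<close>

text \<open>If the arc from \<open>u\<close> to \<open>w\<close> were missing, the reverse arc would
  close a directed triangle in \<open>S\<close>.\<close>

lemma (in tournament) acyclic_digraph_transitive:
  assumes "acyclic_digraph (with_proj T \<restriction> S)" "{u, v, w} \<subseteq> S"
    and "(u, v) \<in> parcs T" "(v, w) \<in> parcs T"
  shows "(u, w) \<in> parcs T"
proof (rule ccontr)
  assume n: "(u, w) \<notin> parcs T"
  have ne: "u \<noteq> v" "v \<noteq> w"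
    using assms(3,4) pair_no_loops by force+
  moreover have "u \<noteq> w"
    using assms(3,4) one_arc[OF _ _ ne(1)] in_arcsD1 in_arcsD2 by blast
  moreover from this have "(w, u) \<in> parcs T"
    using n one_arc assms(3,4) in_arcsD1 in_arcsD2 by blast
  ultimately show False
    using not_acyclic_digraph_triangle[OF assms(3,4)] assms(1,2) by blast
qed

text \<open>The vertices are positions in the enumeration \<open>g\<close>: this puts the tournament
  on \<open>nat\<close>, as the hypothesis requires, and the order of \<open>nat\<close> tells
  forward from backward.\<close>

definition backedge_tournament :: "'a pair_pre_digraph \<Rightarrow> (nat \<Rightarrow> 'a) \<Rightarrow> nat \<Rightarrow> nat pair_pre_digraph" where
  "backedge_tournament G g n = \<lparr>pverts = {..<n}, parcs = {(i, j). i < n \<and> j < n \<and>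
    (i < j \<and> (g i, g j) \<notin> parcs G \<or> j < i \<and> (g i, g j) \<in> parcs G)}\<rparr>"

lemma tournament_backedge_tournament:
  assumes "pair_graph G"
  shows "tournament (backedge_tournament G g n)"
proof -
  interpret pair_graph G by fact
  show ?thesis
  proof unfold_locales
    show "finite (parcs (backedge_tournament G g n))"
      by (rule finite_subset[of _ "{..<n} \<times> {..<n}"]) (auto simp: backedge_tournament_def)
  qed (auto simp: backedge_tournament_def dest: arcs_symmetric)
qed

section \<open>Colouring graphs with bounded cliques through the tournament\<close>

definition clique :: "'a pair_pre_digraph \<Rightarrow> 'a set \<Rightarrow> bool" where
  "clique G S \<longleftrightarrow> S \<subseteq> pverts G \<and> (\<forall>u\<in>S. \<forall>v\<in>S. u \<noteq> v \<longrightarrow> (u, v) \<in> parcs G)"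

text \<open>Each vertex is coloured by its acyclic class together with the size of a largest clique
  in that class that ends at it. An edge within a class raises this size, which stays below
  \<open>N\<close>.\<close>

lemma chromatic_number_le_backedge_tournament:
  assumes "pair_graph G" and g: "bij_betw g {..<n} (pverts G)"
    and clique: "\<And>S. clique G S \<Longrightarrow> card S < N"
  shows "chromatic_number (with_proj G) \<le>
    dichromatic_number (with_proj (backedge_tournament G g n)) * N"
proof -
  let ?T = "backedge_tournament G g n"
  let ?d = "dichromatic_number (with_proj ?T)"
  interpret G: pair_graph G by fact
  interpret T: tournament ?T by (rule tournament_backedge_tournament) fact
  obtain c where c: "\<And>v. v \<in> pverts ?T \<Longrightarrow> c v < ?d"
      "\<And>i. i < ?d \<Longrightarrow> acyclic_digraph (with_proj ?T \<restriction> {v \<in> pverts ?T. c v = i})"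
    by (rule dichromatic_number_colouring[OF T.pair_digraph], rule that)
  \<comment> \<open>A member of \<open>chains j\<close> is a clique inside the class of
    \<open>j\<close>, given by positions, with \<open>j\<close> as its last one.\<close>
  define chains where
    "chains j = {S. S \<subseteq> {..j} \<and> j \<in> S \<and> (\<forall>s\<in>S. c s = c j) \<and> clique G (g ` S)}" for j
  define h where "h j = Max (card ` chains j)" for j
  have inj: "inj_on g {..<n}"
    using g by (simp add: bij_betw_def)
  have gn: "g i \<in> pverts G" if "i < n" for i
    using g that by (auto simp: bij_betw_def)
  have fin: "finite (chains j)" for j
    by (rule finite_subset[of _ "Pow {..j}"]) (auto simp: chains_def)
  have "{j} \<in> chains j" if "j < n" for j
    using gn[OF that] by (auto simp: chains_def clique_def)
  then have h_in: "h j \<in> card ` chains j" if "j < n" for j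
    unfolding h_def using that fin by (intro Max_in) auto
  have h_less: "h j < N" if j: "j < n" for j
  proof -
    obtain S where S: "S \<in> chains j" "h j = card S"
      using h_in[OF j] by auto
    then have "S \<subseteq> {..<n}"
      using j by (auto simp: chains_def)
    then show ?thesis
      using S clique[of "g ` S"] card_image[OF inj_on_subset[OF inj]] by (auto simp: chains_def)
  qed
  \<comment> \<open>A largest clique ending at \<open>i\<close> can be extended by
    \<open>j\<close>.\<close>
  have h_mono: "h i < h j" if ij: "i < j" "j < n" "c i = c j" "(g i, g j) \<in> parcs G" for i j
  proof -
    obtain S where S: "S \<in> chains i" "h i = card S"
      using h_in[of i] ij by auto
    have S_le: "s \<le> i" "c s = c j" if "s \<in> S" for s
      using S(1) that ij(3) by (auto simp: chains_def)
    have "(g s, g j) \<in> parcs G" if s: "s \<in> S" for s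
    proof (cases "s = i")
      case False
      then have "s < i" using S_le(1)[OF s] by simp
      have "g s \<noteq> g i"
        using inj_onD[OF inj, of s i] \<open>s < i\<close> ij by auto
      then have "(g i, g s) \<in> parcs G"
        using S(1) s by (auto simp: chains_def clique_def)
      \<comment> \<open>Both edges give backward arcs, from \<open>j\<close> to \<open>i\<close> and
        from \<open>i\<close> to \<open>s\<close>. Transitivity in the class gives an arc from
        \<open>j\<close> to \<open>s\<close>; as \<open>s < j\<close>, it is backward and hence an
        edge of \<open>G\<close>.\<close>
      then have "(i, s) \<in> parcs ?T" "(j, i) \<in> parcs ?T"
        using \<open>s < i\<close> ij G.arcs_symmetric by (auto simp: backedge_tournament_def)
      then have "(j, s) \<in> parcs ?T"
        using ij \<open>s < i\<close> S_le[OF s] c(1)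
        by (intro T.acyclic_digraph_transitive[OF c(2)[of "c j"], of j i s])
          (auto simp: backedge_tournament_def)
      then show ?thesis
        using \<open>s < i\<close> ij G.arcs_symmetric by (auto simp: backedge_tournament_def)
    qed (use ij in simp)
    then have "insert j S \<in> chains j"
      using S(1) ij gn[OF ij(2)] G.arcs_symmetric by (fastforce simp: chains_def clique_def)
    moreover have "finite S" "j \<notin> S"
      using S_le(1) ij(1) finite_subset[of S "{..i}"] by fastforce+
    moreover from calculation(1) have "card (insert j S) \<le> h j"
      unfolding h_def using fin by (intro Max_ge) auto
    ultimately show ?thesis
      using S(2) by simp
  qed
  let ?i = "inv_into {..<n} g"
  have i: "?i v < n" "g (?i v) = v" if "v \<in> pverts G" for v
    using g that inv_into_into[of v g "{..<n}"] f_inv_into_f[of v g "{..<n}"]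
    by (auto simp: bij_betw_def)
  show ?thesis
  \<comment> \<open>The pair of class and clique size is coded as one number; since \<open>h\<close>
    stays below \<open>N\<close>, division by \<open>N\<close> recovers the class.\<close>
  proof (rule chromatic_number_le[of _ "\<lambda>v. c (?i v) * N + h (?i v)"])
    fix v assume "v \<in> verts (with_proj G)"
    then have *: "?i v < n" using i by simp
    then have "c (?i v) * N + h (?i v) < Suc (c (?i v)) * N"
      using h_less by simp
    also have "\<dots> \<le> ?d * N"
      using c(1)[of "?i v"] * by (intro mult_right_mono) (auto simp: backedge_tournament_def)
    finally show "c (?i v) * N + h (?i v) < ?d * N" .
  next
    fix u v assume "(u, v) \<in> arcs_ends (with_proj G)"
    then have uv: "(u, v) \<in> parcs G" "(v, u) \<in> parcs G"
      using G.arcs_symmetric by auto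
    then have V: "u \<in> pverts G" "v \<in> pverts G" "u \<noteq> v"
      using G.in_arcsD1[OF uv(1)] G.in_arcsD2[OF uv(1)] G.pair_no_loops[OF uv(1)] by auto
    show "c (?i u) * N + h (?i u) \<noteq> c (?i v) * N + h (?i v)"
    proof
      assume eq: "c (?i u) * N + h (?i u) = c (?i v) * N + h (?i v)"
      have N: "h (?i u) < N" "h (?i v) < N"
        using h_less i V by auto
      have ceq: "c (?i u) = c (?i v)"
        using arg_cong[OF eq, of "\<lambda>x. x div N"] N by simp
      then have heq: "h (?i u) = h (?i v)"
        using eq by simp
      have "?i u \<noteq> ?i v"
        using i V by metis
      then show False
        using h_mono[of "?i u" "?i v"] h_mono[of "?i v" "?i u"] i V uv ceq heq
        by (metis nat_neq_iff)
    qed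
  qed
qed

section \<open>Combining the large clique case with the bounded clique case\<close>

lemma pair_digraph_subgraph:
  assumes "subgraph (with_proj H) (with_proj T)" "pair_digraph T"
  shows "pair_digraph H"
proof -
  interpret T: pair_digraph T by fact
  have sub: "pverts H \<subseteq> pverts T" "parcs H \<subseteq> parcs T" "pair_wf_digraph H"
    using assms(1) by (auto simp: subgraph_def wf_digraph_wp_iff)
  interpret H: pair_wf_digraph H by fact
  show ?thesis
  proof
    show "finite (pverts H)" "finite (parcs H)"
      using sub T.pair_finite_verts T.pair_finite_arcs by (blast intro: finite_subset)+
    show "fst e \<noteq> snd e" if "e \<in> parcs H" for e
      using sub(2) that T.pair_no_loops by blast
  qed
qed

theorem theorem4:
  assumes "\<forall>k l :: nat. l \<ge> 3 \<longrightarrow> (\<exists>f :: nat. \<forall>T :: nat pair_pre_digraph.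
    tournament T \<and> dichromatic_number (with_proj T) \<ge> f \<longrightarrow>
      (\<exists>H :: nat pair_pre_digraph. subgraph (with_proj H) (with_proj T) \<and>
         dichromatic_number (with_proj H) > k \<and> digraph_girth (with_proj H) > enat l))"
  shows "\<forall>k l :: nat. l \<ge> 3 \<longrightarrow> (\<exists>f' :: nat. \<forall>G :: 'a pair_pre_digraph.
    pair_graph G \<and> chromatic_number (with_proj G) \<ge> f' \<longrightarrow>
      (\<exists>H :: 'a pair_pre_digraph. pair_graph H \<and> subgraph (with_proj H) (with_proj G) \<and>
         chromatic_number (with_proj H) > k \<and> girth (with_proj H) > enat l))"
proof (intro allI impI)
  fix k l :: nat assume "l \<ge> 3"
  then obtain f where f: "\<And>T :: nat pair_pre_digraph. tournament T \<Longrightarrow>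
      dichromatic_number (with_proj T) \<ge> f \<Longrightarrow>
      \<exists>H :: nat pair_pre_digraph. subgraph (with_proj H) (with_proj T) \<and>
         dichromatic_number (with_proj H) > k \<and> digraph_girth (with_proj H) > enat l"
    using assms by blast
  have large: "\<exists>H :: nat pair_pre_digraph. pair_digraph H \<and> subgraph (with_proj H) (with_proj T) \<and>
         dichromatic_number (with_proj H) > k \<and> digraph_girth (with_proj H) > enat l"
    if "tournament T" "dichromatic_number (with_proj T) \<ge> f" for T :: "nat pair_pre_digraph"
    using f[OF that] pair_digraph_subgraph that(1) tournament.axioms(1) by blast
  \<comment> \<open>Take the blow-up \<open>triangle_blowup f\<close>. As \<open>H0\<close> is fixed
    before \<open>G\<close>, its order may enter the threshold.\<close>
  obtain H0 :: "nat pair_pre_digraph" where H0: "pair_digraph H0"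
      "dichromatic_number (with_proj H0) > k" "digraph_girth (with_proj H0) > enat l"
    using large[OF tournament_triangle_blowup less_imp_le[OF dichromatic_number_triangle_blowup]]
    by blast
  let ?N = "card (pverts H0)"
  show "\<exists>f' :: nat. \<forall>G :: 'a pair_pre_digraph.
    pair_graph G \<and> chromatic_number (with_proj G) \<ge> f' \<longrightarrow>
      (\<exists>H :: 'a pair_pre_digraph. pair_graph H \<and> subgraph (with_proj H) (with_proj G) \<and>
         chromatic_number (with_proj H) > k \<and> girth (with_proj H) > enat l)"
  \<comment> \<open>The \<open>Suc\<close> makes the later comparison of products strict, so that
    the factor \<open>?N\<close> cancels.\<close>
  proof (intro exI[of _ "Suc (f * ?N)"] allI impI, elim conjE)
    fix G :: "'a pair_pre_digraph"
    assume G: "pair_graph G" "Suc (f * ?N) \<le> chromatic_number (with_proj G)"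
    interpret G: pair_graph G by fact
    \<comment> \<open>Both cases are brought to the form that \<open>subgraph_of_injection\<close>
      accepts.\<close>
    have "\<exists>(H :: nat pair_pre_digraph) g. pair_digraph H \<and> dichromatic_number (with_proj H) > k \<and>
        digraph_girth (with_proj H) > enat l \<and> inj_on g (pverts H) \<and> g ` pverts H \<subseteq> pverts G \<and>
        (\<forall>i j. (i, j) \<in> parcs H \<longrightarrow> i < j \<or> (g i, g j) \<in> parcs G)"
    proof (cases "\<exists>S. clique G S \<and> ?N \<le> card S")
      case True
      then obtain S where S: "clique G S" "?N \<le> card S"
        by blast
      interpret H0: pair_digraph H0 by (fact H0)
      have "finite S"
        using S(1) G.pair_finite_verts by (auto simp: clique_def intro: finite_subset)
      then obtain g where g: "g ` pverts H0 \<subseteq> S" "inj_on g (pverts H0)"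
        using card_le_inj[OF H0.pair_finite_verts] S(2) by blast
      \<comment> \<open>Inside a clique every arc of \<open>H0\<close> lands on an edge, whatever
        its direction.\<close>
      have "(g i, g j) \<in> parcs G" if "(i, j) \<in> parcs H0" for i j
      proof -
        have "g i \<noteq> g j"
          using that inj_onD[OF g(2)] H0.in_arcsD1 H0.in_arcsD2 H0.pair_no_loops[OF that] by auto
        then show ?thesis
          using S(1) g(1) H0.in_arcsD1[OF that] H0.in_arcsD2[OF that]
          unfolding clique_def by (meson image_subset_iff)
      qed
      then show ?thesis
        using H0 g S(1) by (intro exI[of _ H0] exI[of _ g]) (auto simp: clique_def)
    next
      case False
      obtain g where g: "bij_betw g {..<card (pverts G)} (pverts G)"
        using ex_bij_betw_nat_finite[OF G.pair_finite_verts] by (auto simp: atLeast0LessThan)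
      let ?T = "backedge_tournament G g (card (pverts G))"
      have "chromatic_number (with_proj G) \<le> dichromatic_number (with_proj ?T) * ?N"
        using False by (intro chromatic_number_le_backedge_tournament G g) auto
      with G(2) have "f * ?N < dichromatic_number (with_proj ?T) * ?N"
        by linarith
      then have "f \<le> dichromatic_number (with_proj ?T)"
        by simp
      then obtain H where H: "pair_digraph H" "subgraph (with_proj H) (with_proj ?T)"
          "dichromatic_number (with_proj H) > k" "digraph_girth (with_proj H) > enat l"
        using large[OF tournament_backedge_tournament[OF G(1)]] by blast
      have sub: "pverts H \<subseteq> {..<card (pverts G)}" "parcs H \<subseteq> parcs ?T"
        using H(2) by (auto simp: subgraph_def backedge_tournament_def)
      have "inj_on g (pverts H)" "g ` pverts H \<subseteq> pverts G"
        using g sub(1) by (auto simp: bij_betw_def intro: inj_on_subset)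
      then show ?thesis
        using H sub(2) by (intro exI[of _ H] exI[of _ g]) (auto simp: backedge_tournament_def)
    qed
    then obtain H :: "nat pair_pre_digraph" and g where
        H: "pair_digraph H" "dichromatic_number (with_proj H) > k"
        "digraph_girth (with_proj H) > enat l" and
        g: "inj_on g (pverts H)" "g ` pverts H \<subseteq> pverts G"
        "\<And>i j. (i, j) \<in> parcs H \<Longrightarrow> i < j \<or> (g i, g j) \<in> parcs G"
      by blast
    show "\<exists>H :: 'a pair_pre_digraph. pair_graph H \<and> subgraph (with_proj H) (with_proj G) \<and>
         chromatic_number (with_proj H) > k \<and> girth (with_proj H) > enat l"
      by (rule subgraph_of_injection[OF G(1) H(1) g]) (use H in \<open>auto intro: less_le_trans\<close>)
  qed
qed

end
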